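(* Let $\mathcal{T}=(t_{ijkl})\in\widehat{\mathcal{E}}_{4,3}$ and let $(i,j,k)$ be a permutation of $(1,2,3)$ such that $t_{iiij}\in\{-1,1\}$ and $t_{ijjj}=t_{jjjk}=t_{jkkk}=t_{iiik}=t_{ikkk}=0$ (so exactly one of $t_{iiij},t_{ijjj},t_{jjjk},t_{jkkk},t_{iiik},t_{ikkk}$ is nonzero). Then $\mathcal{T}$ is positive definite if and only if one of the following conditions is satisfied. (a) $t_{1123}=t_{1223}=t_{1233}=0$, $t_{iijj}=1$ and $t_{iikk},t_{jjkk}\in\{0,1\}$. (b) $t_{ijkk}=0$, $t_{iijk}t_{ijjk}t_{iiij}=1$ and $t_{1122}=t_{2233}=t_{1133}=1$. (c) $t_{ijkk}\in\{-1,1\}$, $t_{iijk}=t_{ijjk}=0$ and $t_{1122}=t_{2233}=t_{1133}=1$. (d) $t_{iijk}=t_{ijkk}=0$, $t_{ijjk}\in\{-1,1\}$ and $t_{1122}=t_{2233}=t_{1133}=1$.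
   Context: A 4th order 3-dimensional real tensor $\mathcal{T}=(t_{ijkl})_{i,j,k,l\in\{1,2,3\}}$ is symmetric if its entries are invariant under all permutations of the four indices (so, e.g., $t_{ijjk}$ denotes the common value of all entries whose index multiset is $\{i,j,j,k\}$). $\widehat{\mathcal{E}}_{4,3}$ is the set of symmetric 4th order 3-dimensional tensors all of whose entries lie in $\{-1,0,1\}$ and whose diagonal entries satisfy $t_{1111}=t_{2222}=t_{3333}=1$. For $x\in\mathbb{R}^3$ put $\mathcal{T}x^4=\sum_{i,j,k,l=1}^3 t_{ijkl}x_ix_jx_kx_l$. $\mathcal{T}$ is positive definite if $\mathcal{T}x^4>0$ for all $x\in\mathbb{R}^3\setminus\{0\}$. *)

theory Defs
  imports "HOL-Analysis.Analysis" "HOL-Combinatorics.Combinatorics"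
begin

text \<open>The index set $\{1,2,3\}$ is the three-element type \<^typ>\<open>3\<close>, as in \<^typ>\<open>real^3\<close>;
  its elements are \<open>1\<close>, \<open>2\<close>, \<open>3\<close> (with \<open>3 = 0\<close>, since numerals are taken modulo 3).\<close>

type_synonym tensor = "3 \<Rightarrow> 3 \<Rightarrow> 3 \<Rightarrow> 3 \<Rightarrow> real"

text \<open>Here \<open>f 1, f 2, f 3, f 4\<close> are the four indices of an entry, and \<open>p\<close> permutes the four
  positions.\<close>

definition symmetric_tensor :: "tensor \<Rightarrow> bool" where
  "symmetric_tensor T \<longleftrightarrow>
     (\<forall>(f :: nat \<Rightarrow> 3) p. p permutes {1..4} \<longrightarrow>
        T (f (p 1)) (f (p 2)) (f (p 3)) (f (p 4)) = T (f 1) (f 2) (f 3) (f 4))"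

definition E_hat :: "tensor set" where
  "E_hat = {T. symmetric_tensor T \<and> (\<forall>i j k l. T i j k l \<in> {-1, 0, 1}) \<and>
               T 1 1 1 1 = 1 \<and> T 2 2 2 2 = 1 \<and> T 3 3 3 3 = 1}"

definition tensor_form :: "tensor \<Rightarrow> real^3 \<Rightarrow> real" where
  "tensor_form T x =
     (\<Sum>i\<in>UNIV. \<Sum>j\<in>UNIV. \<Sum>k\<in>UNIV. \<Sum>l\<in>UNIV. T i j k l * x $ i * x $ j * x $ k * x $ l)"

definition positive_definite_tensor :: "tensor \<Rightarrow> bool" where
  "positive_definite_tensor T \<longleftrightarrow> (\<forall>x. x \<noteq> 0 \<longrightarrow> tensor_form T x > 0)"

end

theory Submission
  imports Defs
begin

text \<open>
  Up to the names of the variables, the form is a ternary quartic without the monomials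
  $xy^3$, $y^3z$, $yz^3$, $x^3z$, $xz^3$, and replacing $y$ by $-y$ makes the coefficient of
  $x^3y$ equal to $4$. Finitely many small integer points at which the form is nonpositive exclude
  every coefficient pattern outside the list; each pattern in the list is settled by an explicit
  sum of squares, the coefficients of which were obtained by rounding a numerically computed
  positive definite Gram matrix.
\<close>

section \<open>Ternary quartics\<close>

text \<open>The factors 4, 6 and 12 count the arrangements of the indices \<open>iiij\<close>,
  \<open>iijj\<close> and \<open>iijk\<close>, so the parameters are tensor entries:
  \<open>s\<close> has indices \<open>iiij\<close>; \<open>a\<close>, \<open>b\<close>,
  \<open>c\<close> have \<open>iijj\<close>, \<open>iikk\<close>, \<open>jjkk\<close>;
  \<open>p\<close>, \<open>q\<close>, \<open>r\<close> have \<open>iijk\<close>,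
  \<open>ijjk\<close>, \<open>ijkk\<close>.\<close>

definition quartic ::
    "real \<Rightarrow> real \<Rightarrow> real \<Rightarrow> real \<Rightarrow> real \<Rightarrow> real \<Rightarrow> real \<Rightarrow> real \<Rightarrow> real \<Rightarrow> real \<Rightarrow> real" where
  "quartic s a b c p q r x y z =
     x^4 + y^4 + z^4 + 4 * s * x^3 * y + 6 * (a * x\<^sup>2 * y\<^sup>2 + b * x\<^sup>2 * z\<^sup>2 + c * y\<^sup>2 * z\<^sup>2)
     + 12 * (p * x\<^sup>2 * y * z + q * x * y\<^sup>2 * z + r * x * y * z\<^sup>2)"

definition quartic_posdef ::
    "real \<Rightarrow> real \<Rightarrow> real \<Rightarrow> real \<Rightarrow> real \<Rightarrow> real \<Rightarrow> real \<Rightarrow> bool" where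
  "quartic_posdef s a b c p q r \<longleftrightarrow>
     (\<forall>x y z. (x, y, z) \<noteq> (0, 0, 0) \<longrightarrow> 0 < quartic s a b c p q r x y z)"

section \<open>Sign changes of the variables\<close>

lemma quartic_flip_y:
  "quartic s a b c p q r x (- y) z = quartic (- s) a b c (- p) q (- r) x y z"
  by (simp add: quartic_def)

lemma quartic_flip_z:
  "quartic s a b c p q r x y (- z) = quartic s a b c (- p) (- q) r x y z"
  by (simp add: quartic_def)

text \<open>Replacing \<open>y\<close> by \<open>- y\<close> permutes the nonzero triples; this
  reduces \<open>s = -1\<close> to \<open>s = 1\<close>.\<close>

lemma quartic_posdef_flip_y:
  "quartic_posdef (- s) a b c (- p) q (- r) \<longleftrightarrow> quartic_posdef s a b c p q r"
  unfolding quartic_posdef_def quartic_flip_y[symmetric]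
  by (metis (no_types, opaque_lifting) add.inverse_inverse neg_equal_0_iff_equal prod.inject)

text \<open>This sign change keeps \<open>s\<close>, so it identifies patterns with opposite
  \<open>p\<close> and \<open>q\<close>.\<close>

lemma quartic_posdef_flip_z:
  "quartic_posdef s a b c (- p) (- q) r \<longleftrightarrow> quartic_posdef s a b c p q r"
  unfolding quartic_posdef_def quartic_flip_z[symmetric]
  by (metis (no_types, opaque_lifting) add.inverse_inverse neg_equal_0_iff_equal prod.inject)

section \<open>Positive definite patterns with \<open>s = 1\<close>\<close>

lemma binary_part_nonneg:
  fixes x y :: real
  shows "0 \<le> x^4 + 4 * x^3 * y + 6 * x\<^sup>2 * y\<^sup>2 + y^4"
    and "x^4 + 4 * x^3 * y + 6 * x\<^sup>2 * y\<^sup>2 + y^4 = 0 \<Longrightarrow> x = 0 \<and> y = 0"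
proof -
  have eq: "x^4 + 4 * x^3 * y + 6 * x\<^sup>2 * y\<^sup>2 + y^4
      = (x\<^sup>2 + 2 * x * y)\<^sup>2 + 2 * (x * y)\<^sup>2 + (y\<^sup>2)\<^sup>2"
    by algebra
  show "0 \<le> x^4 + 4 * x^3 * y + 6 * x\<^sup>2 * y\<^sup>2 + y^4"
    unfolding eq by (intro add_nonneg_nonneg mult_nonneg_nonneg) auto
  assume "x^4 + 4 * x^3 * y + 6 * x\<^sup>2 * y\<^sup>2 + y^4 = 0"
  then have "(x\<^sup>2 + 2 * x * y)\<^sup>2 + 2 * (x * y)\<^sup>2 + (y\<^sup>2)\<^sup>2 = 0"
    unfolding eq .
  then have "y\<^sup>2 = 0" "x\<^sup>2 + 2 * x * y = 0"
    using zero_le_power2[of "x\<^sup>2 + 2 * x * y"] zero_le_power2[of "x * y"] zero_le_power2[of "y\<^sup>2"]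
    by (smt (verit) zero_eq_power2)+
  then show "x = 0 \<and> y = 0"
    by simp
qed

text \<open>For \<open>p = q = 0\<close> and \<open>a = 1\<close> the form is a positive definite
  one, the binary part plus \<open>z^4\<close>, plus six times the assumed expression. This settles
  conditions (a) and (c).\<close>

lemma quartic_posdef_if_remainder_nonneg:
  assumes "\<And>x y z. 0 \<le> b * x\<^sup>2 * z\<^sup>2 + c * y\<^sup>2 * z\<^sup>2 + 2 * r * x * y * z\<^sup>2"
  shows "quartic_posdef 1 1 b c 0 0 r"
  unfolding quartic_posdef_def
proof (intro allI impI)
  fix x y z :: real
  assume nz: "(x, y, z) \<noteq> (0, 0, 0)"
  let ?B = "x^4 + 4 * x^3 * y + 6 * x\<^sup>2 * y\<^sup>2 + y^4"
  have eq: "quartic 1 1 b c 0 0 r x y z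
      = ?B + z^4 + 6 * (b * x\<^sup>2 * z\<^sup>2 + c * y\<^sup>2 * z\<^sup>2 + 2 * r * x * y * z\<^sup>2)"
    by (simp add: quartic_def algebra_simps)
  have "0 < ?B + z^4"
  proof (cases "z = 0")
    case True
    then show ?thesis
      using nz binary_part_nonneg[of x y] by (auto simp: less_le)
  next
    case False
    then have "0 < z^4" by simp
    then show ?thesis
      using binary_part_nonneg(1)[of x y] by linarith
  qed
  moreover have "0 \<le> 6 * (b * x\<^sup>2 * z\<^sup>2 + c * y\<^sup>2 * z\<^sup>2 + 2 * r * x * y * z\<^sup>2)"
    \<comment> \<open>The arguments follow the order in which the variables occur in the assumption,
      so no variables are exchanged.\<close>
    using assms[of x z y] by (rule mult_nonneg_nonneg[rotated]) simp
  ultimately show "0 < quartic 1 1 b c 0 0 r x y z"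
    unfolding eq by (rule add_pos_nonneg)
qed

lemma quartic_posdef_0q0: "quartic_posdef 1 1 1 1 0 1 0"
  unfolding quartic_posdef_def
proof (intro allI impI)
  fix x y z :: real
  assume nz: "(x, y, z) \<noteq> (0, 0, 0)"
  define A where "A = x\<^sup>2 + 2 * x * y + y * z"
  define B where "B = y\<^sup>2 + 2 * x * z"
  define C where "C = z\<^sup>2"
  \<comment> \<open>With \<open>u = x * y\<close>, \<open>v = x * z\<close>,
    \<open>w = y * z\<close>, the squares of \<open>A\<close>, \<open>B\<close>, \<open>C\<close>
    leave \<open>2u^2 + 2v^2 + 5w^2 - 2uv + 4uw\<close>; completing squares in \<open>u\<close>,
    then \<open>v\<close>, gives \<open>D\<close>, \<open>E\<close>, \<open>G\<close>.\<close>
  define D where "D = x * y - x * z / 2 + y * z"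
  define E where "E = x * z + 2 / 3 * (y * z)"
  define G where "G = y * z"
  have eq: "quartic 1 1 1 1 0 1 0 x y z =
      A\<^sup>2 + B\<^sup>2 + C\<^sup>2 + 2 * D\<^sup>2 + 3 / 2 * E\<^sup>2 + 7 / 3 * G\<^sup>2"
    unfolding quartic_def A_def B_def C_def D_def E_def G_def
    by algebra
  have "\<not> quartic 1 1 1 1 0 1 0 x y z \<le> 0"
  proof
    assume "quartic 1 1 1 1 0 1 0 x y z \<le> 0"
    \<comment> \<open>Three squares suffice: \<open>C\<close> forces \<open>z = 0\<close>, then
      \<open>B\<close> forces \<open>y = 0\<close>, then \<open>A\<close> forces
      \<open>x = 0\<close>.\<close>
    then have "A\<^sup>2 = 0" "B\<^sup>2 = 0" "C\<^sup>2 = 0"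
      unfolding eq
      using zero_le_power2[of A] zero_le_power2[of B] zero_le_power2[of C] zero_le_power2[of D]
        zero_le_power2[of E] zero_le_power2[of G]
      by linarith+
    then have "A = 0" "B = 0" "C = 0"
      by simp_all
    then show False
      using nz by (auto simp: A_def B_def C_def)
  qed
  then show "0 < quartic 1 1 1 1 0 1 0 x y z" by simp
qed

lemma quartic_posdef_pq0: "quartic_posdef 1 1 1 1 1 1 0"
  unfolding quartic_posdef_def
proof (intro allI impI)
  fix x y z :: real
  assume nz: "(x, y, z) \<noteq> (0, 0, 0)"
  \<comment> \<open>Elimination on a rational Gram matrix in the basis
    \<open>x^2, y^2, z^2, xy, xz, yz\<close> yields one form per basis element, with leading
    coefficient 1; the weights in \<open>eq\<close> are the positive pivots.\<close>
  define A where "A = x\<^sup>2 - y\<^sup>2 / 3 - z\<^sup>2 / 3 + 2 * x * y + 2 * y * z"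
  define B where "B = y\<^sup>2 - z\<^sup>2 / 8 + 3 / 4 * (x * y) + 3 / 2 * (x * z) + 3 / 4 * (y * z)"
  define C where "C = z\<^sup>2 + 2 / 21 * (x * y) + 4 / 21 * (x * z) + 6 / 7 * (y * z)"
  define D where "D = x * y + 47 / 34 * (x * z) + 3 / 68 * (y * z)"
  define E where "E = x * z - 31 / 26 * (y * z)"
  define G where "G = y * z"
  have eq: "quartic 1 1 1 1 1 1 0 x y z =
      A\<^sup>2 + 8 / 9 * B\<^sup>2 + 7 / 8 * C\<^sup>2 + 136 / 63 * D\<^sup>2 + 26 / 51 * E\<^sup>2 + 5 / 39 * G\<^sup>2"
    unfolding quartic_def A_def B_def C_def D_def E_def G_def
    by algebra
  have "\<not> quartic 1 1 1 1 1 1 0 x y z \<le> 0"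
  proof
    assume "quartic 1 1 1 1 1 1 0 x y z \<le> 0"
    then have "A\<^sup>2 = 0" "B\<^sup>2 = 0" "C\<^sup>2 = 0" "D\<^sup>2 = 0" "E\<^sup>2 = 0" "G\<^sup>2 = 0"
      unfolding eq
      using zero_le_power2[of A] zero_le_power2[of B] zero_le_power2[of C] zero_le_power2[of D]
        zero_le_power2[of E] zero_le_power2[of G]
      by linarith+
    then have "A = 0" "B = 0" "C = 0" "D = 0" "E = 0" "G = 0"
      by simp_all
    \<comment> \<open>Back substitution through the triangular system: \<open>G\<close>,
      \<open>E\<close>, \<open>D\<close> remove the products, after which \<open>C\<close>,
      \<open>B\<close>, \<open>A\<close> remove the squares.\<close>
    then have "y * z = 0" "x * z = 0" "x * y = 0"
      unfolding D_def E_def G_def by linarith+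
    with \<open>A = 0\<close> \<open>B = 0\<close> \<open>C = 0\<close> show False
      using nz by (auto simp: A_def B_def C_def)
  qed
  then show "0 < quartic 1 1 1 1 1 1 0 x y z" by simp
qed

lemma quartic_posdef_iff_1:
  assumes "a \<in> {-1, 0, 1}" "b \<in> {-1, 0, 1}" "c \<in> {-1, 0, 1}"
    and "p \<in> {-1, 0, 1}" "q \<in> {-1, 0, 1}" "r \<in> {-1, 0, 1}"
  shows "quartic_posdef 1 a b c p q r \<longleftrightarrow>
     (p = 0 \<and> q = 0 \<and> r = 0 \<and> a = 1 \<and> b \<in> {0, 1} \<and> c \<in> {0, 1}) \<or>
     (r = 0 \<and> p * q = 1 \<and> a = 1 \<and> b = 1 \<and> c = 1) \<or>
     (r \<in> {-1, 1} \<and> p = 0 \<and> q = 0 \<and> a = 1 \<and> b = 1 \<and> c = 1) \<or>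
     (p = 0 \<and> r = 0 \<and> q \<in> {-1, 1} \<and> a = 1 \<and> b = 1 \<and> c = 1)"
    (is "_ \<longleftrightarrow> ?cond")
proof
  assume "quartic_posdef 1 a b c p q r"
  then have pos: "0 < quartic 1 a b c p q r x y z" if "(x, y, z) \<noteq> (0, 0, 0)" for x y z
    using that by (auto simp: quartic_posdef_def)
  note pts = pos[unfolded quartic_def]
  \<comment> \<open>On the coordinate planes the three points give \<open>2 + 6c\<close>,
    \<open>6a - 2\<close> and \<open>2 + 6b\<close>.\<close>
  have "c \<in> {0, 1}"
    using pts[of 0 "-1" "-1"] assms(3) by auto
  moreover have "a = 1"
    using pts[of 1 "-1" 0] assms(1) by auto
  moreover have "b \<in> {0, 1}"
    using pts[of 1 0 "-1"] assms(2) by auto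
  \<comment> \<open>Values of the form with \<open>a = 1\<close> at the points listed below, in the
    same order. Of the 108 patterns left for \<open>b, c, p, q, r\<close>, only the ten listed ones
    satisfy all twelve inequalities. For instance, \<open>(2, -1, -1)\<close> and
    \<open>(2, -1, 1)\<close> exclude a lone nonzero \<open>p\<close>.\<close>
  moreover have
    "0 < 13 + 6 * b + 6 * c + 12 * p + 12 * q + 12 * r"
    "0 < 5 + 6 * b + 6 * c + 12 * p - 12 * q - 12 * r"
    "0 < 5 + 6 * b + 6 * c - 12 * p + 12 * q - 12 * r"
    "0 < 28 + 24 * b + 24 * c - 24 * p - 24 * q + 48 * r"
    "0 < 13 + 6 * b + 6 * c - 12 * p - 12 * q + 12 * r"
    "0 < 154 + 216 * b + 54 * c - 144 * p - 72 * q + 216 * r"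
    "0 < 65 + 24 * b + 96 * c - 48 * p - 96 * q + 96 * r"
    "0 < 10 + 24 * b + 6 * c + 48 * p - 24 * q - 24 * r"
    "0 < 273 + 216 * b + 216 * c + 288 * p + 288 * q + 432 * r"
    "0 < 65 + 24 * b + 96 * c + 48 * p + 96 * q + 96 * r"
    "0 < 10 + 24 * b + 6 * c - 48 * p + 24 * q - 24 * r"
    "0 < 273 + 216 * b + 216 * c - 288 * p - 288 * q + 432 * r"
    using
      pts[of 1 1 1] pts[of 1 "-1" "-1"] pts[of 1 "-1" 1] pts[of 1 1 "-2"]
      pts[of 1 1 "-1"] pts[of 2 1 "-3"] pts[of 1 2 "-2"] pts[of 2 "-1" "-1"]
      pts[of 2 2 3] pts[of 1 2 2] pts[of 2 "-1" 1] pts[of 2 2 "-3"] \<open>a = 1\<close>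
    by simp_all
  ultimately show ?cond
    using assms(4-6) by (elim insertE emptyE; simp)
next
  assume ?cond
  \<comment> \<open>The condition \<open>p * q = 1\<close> splits by the common sign, and a lone
    \<open>q\<close> by its sign; the negative cases follow from the positive ones by flipping
    \<open>z\<close>.\<close>
  then consider "p = 0" "q = 0" "r = 0" "a = 1" "b \<in> {0, 1}" "c \<in> {0, 1}"
    | "p = 1" "q = 1" "r = 0" "a = 1" "b = 1" "c = 1"
    | "p = -1" "q = -1" "r = 0" "a = 1" "b = 1" "c = 1"
    | "p = 0" "q = 0" "r \<in> {-1, 1}" "a = 1" "b = 1" "c = 1"
    | "p = 0" "q = 1" "r = 0" "a = 1" "b = 1" "c = 1"
    | "p = 0" "q = -1" "r = 0" "a = 1" "b = 1" "c = 1"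
    using assms(4,5) by auto
  then show "quartic_posdef 1 a b c p q r"
  proof cases
    case 1
    then show ?thesis
      by (auto intro!: quartic_posdef_if_remainder_nonneg)
  next
    case 2
    then show ?thesis using quartic_posdef_pq0 by simp
  next
    case 3
    then show ?thesis
      using quartic_posdef_pq0 quartic_posdef_flip_z[of 1 1 1 1 1 1 0] by simp
  next
    case 4
    \<comment> \<open>Since \<open>r^2 = 1\<close>, the remainder is a perfect square.\<close>
    have "0 \<le> x\<^sup>2 * z\<^sup>2 + y\<^sup>2 * z\<^sup>2 + 2 * r * x * y * z\<^sup>2" for x y z :: real
    proof -
      have "x\<^sup>2 * z\<^sup>2 + y\<^sup>2 * z\<^sup>2 + 2 * r * x * y * z\<^sup>2 = ((x + r * y) * z)\<^sup>2"
        using 4(3) by (auto simp: power2_eq_square algebra_simps)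
      then show ?thesis by simp
    qed
    with 4 show ?thesis
      using quartic_posdef_if_remainder_nonneg[of 1 1 r] by simp
  next
    case 5
    then show ?thesis using quartic_posdef_0q0 by simp
  next
    case 6
    then show ?thesis
      using quartic_posdef_0q0 quartic_posdef_flip_z[of 1 1 1 1 0 1 0] by simp
  qed
qed

text \<open>Flipping \<open>y\<close> negates \<open>s\<close>, \<open>p\<close> and
  \<open>r\<close>. The product \<open>p * q * s\<close> is invariant, which accounts for the factor
  \<open>s\<close> absent from the case \<open>s = 1\<close>.\<close>

lemma quartic_posdef_iff:
  assumes "s \<in> {-1, 1}"
    and "a \<in> {-1, 0, 1}" "b \<in> {-1, 0, 1}" "c \<in> {-1, 0, 1}"
    and "p \<in> {-1, 0, 1}" "q \<in> {-1, 0, 1}" "r \<in> {-1, 0, 1}"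
  shows "quartic_posdef s a b c p q r \<longleftrightarrow>
     (p = 0 \<and> q = 0 \<and> r = 0 \<and> a = 1 \<and> b \<in> {0, 1} \<and> c \<in> {0, 1}) \<or>
     (r = 0 \<and> p * q * s = 1 \<and> a = 1 \<and> b = 1 \<and> c = 1) \<or>
     (r \<in> {-1, 1} \<and> p = 0 \<and> q = 0 \<and> a = 1 \<and> b = 1 \<and> c = 1) \<or>
     (p = 0 \<and> r = 0 \<and> q \<in> {-1, 1} \<and> a = 1 \<and> b = 1 \<and> c = 1)"
proof (cases "s = 1")
  case True
  then show ?thesis
    using quartic_posdef_iff_1[OF assms(2-7)] by simp
next
  case False
  then have s: "s = -1" using assms(1) by simp
  have neg: "- p \<in> {-1, 0, 1}" "- r \<in> {-1, 0, 1}" using assms(5,7) by auto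
  have "quartic_posdef s a b c p q r \<longleftrightarrow> quartic_posdef 1 a b c (- p) q (- r)"
    using quartic_posdef_flip_y[of s a b c p q r] s by simp
  moreover have "- r \<in> {-1, 1} \<longleftrightarrow> r \<in> {-1, 1}"
    using assms(7) by auto
  ultimately show ?thesis
    using quartic_posdef_iff_1[OF assms(2-4) neg(1) assms(6) neg(2)] s by simp
qed

section \<open>Symmetric tensors\<close>

text \<open>Adjacent transpositions generate all permutations of the four positions, so these
  equations suffice to sort indices.\<close>

lemma symmetric_tensor_swap:
  assumes "symmetric_tensor T"
  shows "T b a c d = T a b c d" "T a c b d = T a b c d" "T a b d c = T a b c d"
proof -
  \<comment> \<open>The last branch supplies the fourth index; positions outside 1 to 4 are
    irrelevant.\<close>
  let ?f = "\<lambda>n::nat. if n = 1 then a else if n = 2 then b else if n = 3 then c else d"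
  let ?t = "Transposition.transpose :: nat \<Rightarrow> nat \<Rightarrow> nat \<Rightarrow> nat"
  have swap: "T (?f (?t m n 1)) (?f (?t m n 2)) (?f (?t m n 3)) (?f (?t m n 4)) = T a b c d"
    if "m \<in> {1..4}" "n \<in> {1..4}" for m n
    using assms[unfolded symmetric_tensor_def, rule_format, of "?t m n" ?f]
      permutes_swap_id[OF that] by simp
  show "T b a c d = T a b c d"
    using swap[of 1 2] by (simp add: Transposition.transpose_def)
  show "T a c b d = T a b c d"
    using swap[of 2 3] by (simp add: Transposition.transpose_def)
  show "T a b d c = T a b c d"
    using swap[of 3 4] by (simp add: Transposition.transpose_def)
qed

lemma tensor_form_eq_quartic:
  assumes sym: "symmetric_tensor T" and dist: "distinct [i, j, k]" and univ: "UNIV = {i, j, k}"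
    and diag: "T i i i i = 1" "T j j j j = 1" "T k k k k = 1"
    and zero: "T i j j j = 0" "T j j j k = 0" "T j k k k = 0" "T i i i k = 0" "T i k k k = 0"
  shows "tensor_form T x = quartic (T i i i j) (T i i j j) (T i i k k) (T j j k k)
    (T i i j k) (T i j j k) (T i j k k) (x $ i) (x $ j) (x $ k)"
proof -
  note swap = symmetric_tensor_swap[OF sym]
  have sum3: "(\<Sum>m\<in>UNIV. f m) = f i + f j + f k" for f :: "3 \<Rightarrow> real"
    unfolding univ using dist by simp
  \<comment> \<open>Only inversions of the order \<open>i, j, k\<close> are rewritten, as in bubble
    sort; each of the 81 entries thus reaches its sorted form and equal monomials collect.\<close>
  have ji: "T j i c d = T i j c d" "T k i c d = T i k c d" "T k j c d = T j k c d" for c d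
    by (rule swap(1))+
  have ji2: "T c j i d = T c i j d" "T c k i d = T c i k d" "T c k j d = T c j k d" for c d
    by (rule swap(2))+
  have ji3: "T c d j i = T c d i j" "T c d k i = T c d i k" "T c d k j = T c d j k" for c d
    by (rule swap(3))+
  show ?thesis
    unfolding tensor_form_def sum3 ji ji2 ji3 diag zero quartic_def
    by (simp add: ji ji2 ji3 diag zero algebra_simps power2_eq_square power3_eq_cube
        power4_eq_xxxx)
qed

lemma positive_definite_tensor_iff_quartic_posdef:
  assumes dist: "distinct [i, j, k]" and univ: "UNIV = {i, j, k}"
    and form: "\<And>x. tensor_form T x = quartic s a b c p q r (x $ i) (x $ j) (x $ k)"
  shows "positive_definite_tensor T \<longleftrightarrow> quartic_posdef s a b c p q r"
proof
  assume pd: "positive_definite_tensor T"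
  show "quartic_posdef s a b c p q r"
    unfolding quartic_posdef_def
  proof (intro allI impI)
    fix x y z :: real
    assume nz: "(x, y, z) \<noteq> (0, 0, 0)"
    define v :: "real^3" where "v = (\<chi> m. if m = i then x else if m = j then y else z)"
    have v: "v $ i = x" "v $ j = y" "v $ k = z"
      using dist by (auto simp: v_def)
    then have "v \<noteq> 0" using nz by auto
    then show "0 < quartic s a b c p q r x y z"
      using pd form[of v] unfolding v positive_definite_tensor_def by metis
  qed
next
  assume pd: "quartic_posdef s a b c p q r"
  show "positive_definite_tensor T"
    unfolding positive_definite_tensor_def
  proof (intro allI impI)
    fix v :: "real^3"
    assume "v \<noteq> 0"
    then obtain m where "v $ m \<noteq> 0" by (auto simp: vec_eq_iff)
    moreover have "m \<in> {i, j, k}" using univ by blast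
    ultimately have "(v $ i, v $ j, v $ k) \<noteq> (0, 0, 0)" by auto
    then show "0 < tensor_form T v"
      using pd form[of v] by (simp add: quartic_posdef_def)
  qed
qed

theorem theorem3p6:
  fixes T :: tensor and i j k :: 3
  assumes "T \<in> E_hat"
    and "[i, j, k] \<in> permutations_of_set {1, 2, 3}"
    and "T i i i j \<in> {-1, 1}"
    and "T i j j j = 0" and "T j j j k = 0" and "T j k k k = 0"
    and "T i i i k = 0" and "T i k k k = 0"
  shows "positive_definite_tensor T \<longleftrightarrow>
     (T 1 1 2 3 = 0 \<and> T 1 2 2 3 = 0 \<and> T 1 2 3 3 = 0 \<and>
        T i i j j = 1 \<and> T i i k k \<in> {0, 1} \<and> T j j k k \<in> {0, 1}) \<or>
     (T i j k k = 0 \<and> T i i j k * T i j j k * T i i i j = 1 \<and>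
        T 1 1 2 2 = 1 \<and> T 2 2 3 3 = 1 \<and> T 1 1 3 3 = 1) \<or>
     (T i j k k \<in> {-1, 1} \<and> T i i j k = 0 \<and> T i j j k = 0 \<and>
        T 1 1 2 2 = 1 \<and> T 2 2 3 3 = 1 \<and> T 1 1 3 3 = 1) \<or>
     (T i i j k = 0 \<and> T i j k k = 0 \<and> T i j j k \<in> {-1, 1} \<and>
        T 1 1 2 2 = 1 \<and> T 2 2 3 3 = 1 \<and> T 1 1 3 3 = 1)"
proof -
  have sym: "symmetric_tensor T" and entries: "\<And>a b c d. T a b c d \<in> {-1, 0, 1}"
    and "T 1 1 1 1 = 1" "T 2 2 2 2 = 1" "T 3 3 3 3 = 1"
    using assms(1) by (auto simp: E_hat_def)
  have dist: "distinct [i, j, k]" and set: "{i, j, k} = {1, 2, 3}"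
    using assms(2) by (auto simp: permutations_of_set_def)
  have univ: "UNIV = {i, j, k}"
    using set UNIV_3 by simp
  have diag: "T m m m m = 1" for m
    using exhaust_3[of m] \<open>T 1 1 1 1 = 1\<close> \<open>T 2 2 2 2 = 1\<close> \<open>T 3 3 3 3 = 1\<close> by auto
  have pd: "positive_definite_tensor T \<longleftrightarrow>
      quartic_posdef (T i i i j) (T i i j j) (T i i k k) (T j j k k)
        (T i i j k) (T i j j k) (T i j k k)"
    using tensor_form_eq_quartic[OF sym dist univ diag diag diag assms(4-8)]
    by (rule positive_definite_tensor_iff_quartic_posdef[OF dist univ])
  note swap = symmetric_tensor_swap[OF sym]
  have perm: "(i, j, k) \<in> {(1,2,3), (1,3,2), (2,1,3), (2,3,1), (3,1,2), (3,2,1)}"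
    using dist exhaust_3[of i] exhaust_3[of j] exhaust_3[of k] by auto
  have ji: "T 2 1 c d = T 1 2 c d" "T 3 1 c d = T 1 3 c d" "T 3 2 c d = T 2 3 c d" for c d
    by (rule swap(1))+
  have ji2: "T c 2 1 d = T c 1 2 d" "T c 3 1 d = T c 1 3 d" "T c 3 2 d = T c 2 3 d" for c d
    by (rule swap(2))+
  have ji3: "T c d 2 1 = T c d 1 2" "T c d 3 1 = T c d 1 3" "T c d 3 2 = T c d 2 3" for c d
    by (rule swap(3))+
  \<comment> \<open>A relabelling permutes the three entries with exactly one repeated index among
    themselves, so their joint vanishing does not depend on \<open>(i, j, k)\<close>. The same holds
    for the entries in \<open>squares\<close>.\<close>
  have mixed: "T 1 1 2 3 = 0 \<and> T 1 2 2 3 = 0 \<and> T 1 2 3 3 = 0 \<longleftrightarrow>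
      T i i j k = 0 \<and> T i j j k = 0 \<and> T i j k k = 0"
    using perm by (auto simp: ji ji2 ji3)
  have squares: "T 1 1 2 2 = 1 \<and> T 2 2 3 3 = 1 \<and> T 1 1 3 3 = 1 \<longleftrightarrow>
      T i i j j = 1 \<and> T i i k k = 1 \<and> T j j k k = 1"
    using perm by (auto simp: ji ji2 ji3)
  show ?thesis
    unfolding pd quartic_posdef_iff[OF assms(3) entries entries entries entries entries entries]
    using mixed squares by meson
qed

end
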